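(* Let $L$ be either of the sequent calculi $\mathrm{lTS4}$ or $\mathrm{gTS4}$ defined in the context. Then $L$ has the subformula property: if a sequent $S$ is provable in $L$, then there is a proof $P$ of $S$ in $L$ such that every formula appearing in $P$ is a subformula of some formula in $S$.
   Context: Formulas are built from countably many propositional variables using the binary connectives $\wedge,\vee,\to$ and the unary connectives $\neg,\Box,\Diamond$; subformulas are defined as usual (the subformulas of $\neg\alpha$, $\Box\alpha$, $\Diamond\alpha$ are the formula itself and the subformulas of $\alpha$, etc.). Letters $\Gamma,\Delta$ (possibly with subscripts) denote finite, possibly empty, sets of formulas; a sequent is an expression $\Gamma\Rightarrow\Delta$; a comma denotes union. For a word $w$ over $\{\neg,\Box,\Diamond\}$, $w\Gamma=\{w\gamma:\gamma\in\Gamma\}$. A rule "$S_1;\dots;S_n\,/\,S$" has premises $S_1,\dots,S_n$ and conclusion $S$. The calculus lTS4. Initial sequents: for every propositional variable $p$: $p\Rightarrow p$, $\neg p\Rightarrow\neg p$, $\neg p,p\Rightarrow$, and $\Rightarrow\neg p,p$. Structural rules: (cut) $\Gamma\Rightarrow\alpha$; $\alpha,\Gamma\Rightarrow\Delta$ / $\Gamma\Rightarrow\Delta$. (we-left) $\Gamma\Rightarrow\Delta$ / $\alpha,\Gamma\Rightarrow\Delta$. (we-right) $\Gamma\Rightarrow\Delta$ / $\Gamma\Rightarrow\Delta,\alpha$. Non-twist logical rules: ($\wedge$left) $\alpha,\beta,\Gamma\Rightarrow\Delta$ / $\alpha\wedge\beta,\Gamma\Rightarrow\Delta$. ($\wedge$right)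 $\Gamma\Rightarrow\Delta,\alpha$; $\Gamma\Rightarrow\Delta,\beta$ / $\Gamma\Rightarrow\Delta,\alpha\wedge\beta$. ($\vee$left) $\alpha,\Gamma\Rightarrow\Delta$; $\beta,\Gamma\Rightarrow\Delta$ / $\alpha\vee\beta,\Gamma\Rightarrow\Delta$. ($\vee$right) $\Gamma\Rightarrow\Delta,\alpha,\beta$ / $\Gamma\Rightarrow\Delta,\alpha\vee\beta$. ($\to$left) $\Gamma\Rightarrow\Delta,\alpha$; $\beta,\Gamma\Rightarrow\Delta$ / $\alpha\to\beta,\Gamma\Rightarrow\Delta$. ($\to$right) $\alpha,\Gamma\Rightarrow\Delta,\beta$ / $\Gamma\Rightarrow\Delta,\alpha\to\beta$. ($\Box$left) $\alpha,\Gamma\Rightarrow\Delta$ / $\Box\alpha,\Gamma\Rightarrow\Delta$. ($\Box$right) $\Box\Gamma_1,\neg\Diamond\Gamma_2\Rightarrow\Diamond\Delta_1,\neg\Box\Delta_2,\alpha$ / $\Box\Gamma_1,\neg\Diamond\Gamma_2\Rightarrow\Diamond\Delta_1,\neg\Box\Delta_2,\Box\alpha$. ($\Diamond$left) $\alpha,\Box\Gamma_1,\neg\Diamond\Gamma_2\Rightarrow\Diamond\Delta_1,\neg\Box\Delta_2$ / $\Diamond\alpha,\Box\Gamma_1,\neg\Diamond\Gamma_2\Rightarrow\Diamond\Delta_1,\neg\Box\Delta_2$. ($\Diamond$right) $\Gamma\Rightarrow\Delta,\alpha$ / $\Gamma\Rightarrow\Delta,\Diamond\alpha$. Twist rules: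 ($\neg\neg$left$^t$) $\alpha,\Gamma\Rightarrow\Delta$ / $\neg\neg\alpha,\Gamma\Rightarrow\Delta$. ($\neg\neg$right$^t$) $\Gamma\Rightarrow\Delta,\alpha$ / $\Gamma\Rightarrow\Delta,\neg\neg\alpha$. ($\neg\wedge$left$^t$) $\Gamma\Rightarrow\Delta,\alpha$; $\Gamma\Rightarrow\Delta,\beta$ / $\neg(\alpha\wedge\beta),\Gamma\Rightarrow\Delta$. ($\neg\wedge$right$^t$) $\alpha,\beta,\Gamma\Rightarrow\Delta$ / $\Gamma\Rightarrow\Delta,\neg(\alpha\wedge\beta)$. ($\neg\vee$left$^t$) $\Gamma\Rightarrow\Delta,\alpha,\beta$ / $\neg(\alpha\vee\beta),\Gamma\Rightarrow\Delta$. ($\neg\vee$right$^t$) $\alpha,\Gamma\Rightarrow\Delta$; $\beta,\Gamma\Rightarrow\Delta$ / $\Gamma\Rightarrow\Delta,\neg(\alpha\vee\beta)$. ($\neg\to$left$^t$) $\alpha,\Gamma\Rightarrow\Delta,\beta$ / $\neg(\alpha\to\beta),\Gamma\Rightarrow\Delta$. ($\neg\to$right$^t$) $\Gamma\Rightarrow\Delta,\alpha$; $\beta,\Gamma\Rightarrow\Delta$ / $\Gamma\Rightarrow\Delta,\neg(\alpha\to\beta)$. ($\neg\Box$left$^t$) $\Box\Gamma_1,\neg\Diamond\Gamma_2\Rightarrow\Diamond\Delta_1,\neg\Box\Delta_2,\alpha$ / $\neg\Box\alpha,\Box\Gamma_1,\neg\Diamond\Gamma_2\Rightarrow\Diamond\Delta_1,\neg\Box\Delta_2$.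 ($\neg\Box$right$^t$) $\alpha,\Gamma\Rightarrow\Delta$ / $\Gamma\Rightarrow\Delta,\neg\Box\alpha$. ($\neg\Diamond$left$^t$) $\Gamma\Rightarrow\Delta,\alpha$ / $\neg\Diamond\alpha,\Gamma\Rightarrow\Delta$. ($\neg\Diamond$right$^t$) $\alpha,\Box\Gamma_1,\neg\Diamond\Gamma_2\Rightarrow\Diamond\Delta_1,\neg\Box\Delta_2$ / $\Box\Gamma_1,\neg\Diamond\Gamma_2\Rightarrow\Diamond\Delta_1,\neg\Box\Delta_2,\neg\Diamond\alpha$. The calculus gTS4 is obtained from lTS4 by replacing ($\Box$right), ($\Diamond$left), ($\neg\Box$left$^t$), ($\neg\Diamond$right$^t$) with: ($\Box$right$^T$) $\Box\Gamma_1,\Box\Delta_2\Rightarrow\Diamond\Delta_1,\Diamond\Gamma_2,\alpha$ / $\Box\Gamma_1,\neg\Diamond\Gamma_2\Rightarrow\Diamond\Delta_1,\neg\Box\Delta_2,\Box\alpha$. ($\Diamond$left$^T$) $\alpha,\Box\Gamma_1,\Box\Delta_2\Rightarrow\Diamond\Delta_1,\Diamond\Gamma_2$ / $\Diamond\alpha,\Box\Gamma_1,\neg\Diamond\Gamma_2\Rightarrow\Diamond\Delta_1,\neg\Box\Delta_2$. ($\neg\Box$left$^T$) $\Box\Gamma_1,\Box\Delta_2\Rightarrow\Diamond\Delta_1,\Diamond\Gamma_2,\alpha$ / $\neg\Box\alpha,\Box\Gamma_1,\neg\Diamond\Gamma_2\Rightarrow\Diamond\Delta_1,\neg\Box\Delta_2$.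 ($\neg\Diamond$right$^T$) $\alpha,\Box\Gamma_1,\Box\Delta_2\Rightarrow\Diamond\Delta_1,\Diamond\Gamma_2$ / $\Box\Gamma_1,\neg\Diamond\Gamma_2\Rightarrow\Diamond\Delta_1,\neg\Box\Delta_2,\neg\Diamond\alpha$. (All other rules and initial sequents of lTS4, including ($\neg\Diamond$left$^t$), are kept.) *)

theory Defs
  imports Main "HOL-Library.FSet"
begin

datatype fm =
    Var nat
  | Conj fm fm
  | Disj fm fm
  | Imp fm fm
  | Neg fm
  | Box fm
  | Dia fm

primrec subformulas :: "fm \<Rightarrow> fm set" where
  "subformulas (Var p) = {Var p}"
| "subformulas (Conj \<alpha> \<beta>) = {Conj \<alpha> \<beta>} \<union> subformulas \<alpha> \<union> subformulas \<beta>"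
| "subformulas (Disj \<alpha> \<beta>) = {Disj \<alpha> \<beta>} \<union> subformulas \<alpha> \<union> subformulas \<beta>"
| "subformulas (Imp \<alpha> \<beta>) = {Imp \<alpha> \<beta>} \<union> subformulas \<alpha> \<union> subformulas \<beta>"
| "subformulas (Neg \<alpha>) = {Neg \<alpha>} \<union> subformulas \<alpha>"
| "subformulas (Box \<alpha>) = {Box \<alpha>} \<union> subformulas \<alpha>"
| "subformulas (Dia \<alpha>) = {Dia \<alpha>} \<union> subformulas \<alpha>"

datatype sequent = Sequent "fm fset" "fm fset"  (infix \<open>\<Rrightarrow>\<close> 50)

primrec sequent_formulas :: "sequent \<Rightarrow> fm set" where
  "sequent_formulas (\<Gamma> \<Rrightarrow> \<Delta>) = fset \<Gamma> \<union> fset \<Delta>"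

abbreviation boxes :: "fm fset \<Rightarrow> fm fset" where
  "boxes \<Gamma> \<equiv> Box |`| \<Gamma>"

abbreviation dias :: "fm fset \<Rightarrow> fm fset" where
  "dias \<Gamma> \<equiv> Dia |`| \<Gamma>"

abbreviation negs :: "fm fset \<Rightarrow> fm fset" where
  "negs \<Gamma> \<equiv> Neg |`| \<Gamma>"

text \<open>
  A calculus is the set of its rule instances, given as a relation between the list of
  premises and the conclusion; initial sequents are the instances without premises.
  A comma in front of or behind a single formula is \<^const>\<open>finsert\<close>, so the principal formula
  may also occur in the context (contraction is implicit).
\<close>

type_synonym calculus = "sequent list \<Rightarrow> sequent \<Rightarrow> bool"

inductive TS4_common :: calculus where
  init_pos: "TS4_common [] ({|Var p|} \<Rrightarrow> {|Var p|})"
| init_neg: "TS4_common [] ({|Neg (Var p)|} \<Rrightarrow> {|Neg (Var p)|})"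
| init_left: "TS4_common [] ({|Neg (Var p), Var p|} \<Rrightarrow> {||})"
| init_right: "TS4_common [] ({||} \<Rrightarrow> {|Neg (Var p), Var p|})"
| cut: "TS4_common [\<Gamma> \<Rrightarrow> {|\<alpha>|}, finsert \<alpha> \<Gamma> \<Rrightarrow> \<Delta>] (\<Gamma> \<Rrightarrow> \<Delta>)"
| we_left: "TS4_common [\<Gamma> \<Rrightarrow> \<Delta>] (finsert \<alpha> \<Gamma> \<Rrightarrow> \<Delta>)"
| we_right: "TS4_common [\<Gamma> \<Rrightarrow> \<Delta>] (\<Gamma> \<Rrightarrow> finsert \<alpha> \<Delta>)"
| conj_left: "TS4_common [finsert \<alpha> (finsert \<beta> \<Gamma>) \<Rrightarrow> \<Delta>] (finsert (Conj \<alpha> \<beta>) \<Gamma> \<Rrightarrow> \<Delta>)"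
| conj_right: "TS4_common [\<Gamma> \<Rrightarrow> finsert \<alpha> \<Delta>, \<Gamma> \<Rrightarrow> finsert \<beta> \<Delta>] (\<Gamma> \<Rrightarrow> finsert (Conj \<alpha> \<beta>) \<Delta>)"
| disj_left: "TS4_common [finsert \<alpha> \<Gamma> \<Rrightarrow> \<Delta>, finsert \<beta> \<Gamma> \<Rrightarrow> \<Delta>] (finsert (Disj \<alpha> \<beta>) \<Gamma> \<Rrightarrow> \<Delta>)"
| disj_right: "TS4_common [\<Gamma> \<Rrightarrow> finsert \<alpha> (finsert \<beta> \<Delta>)] (\<Gamma> \<Rrightarrow> finsert (Disj \<alpha> \<beta>) \<Delta>)"
| imp_left: "TS4_common [\<Gamma> \<Rrightarrow> finsert \<alpha> \<Delta>, finsert \<beta> \<Gamma> \<Rrightarrow> \<Delta>] (finsert (Imp \<alpha> \<beta>) \<Gamma> \<Rrightarrow> \<Delta>)"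
| imp_right: "TS4_common [finsert \<alpha> \<Gamma> \<Rrightarrow> finsert \<beta> \<Delta>] (\<Gamma> \<Rrightarrow> finsert (Imp \<alpha> \<beta>) \<Delta>)"
| box_left: "TS4_common [finsert \<alpha> \<Gamma> \<Rrightarrow> \<Delta>] (finsert (Box \<alpha>) \<Gamma> \<Rrightarrow> \<Delta>)"
| dia_right: "TS4_common [\<Gamma> \<Rrightarrow> finsert \<alpha> \<Delta>] (\<Gamma> \<Rrightarrow> finsert (Dia \<alpha>) \<Delta>)"
| neg_neg_left: "TS4_common [finsert \<alpha> \<Gamma> \<Rrightarrow> \<Delta>] (finsert (Neg (Neg \<alpha>)) \<Gamma> \<Rrightarrow> \<Delta>)"
| neg_neg_right: "TS4_common [\<Gamma> \<Rrightarrow> finsert \<alpha> \<Delta>] (\<Gamma> \<Rrightarrow> finsert (Neg (Neg \<alpha>)) \<Delta>)"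
| neg_conj_left:
    "TS4_common [\<Gamma> \<Rrightarrow> finsert \<alpha> \<Delta>, \<Gamma> \<Rrightarrow> finsert \<beta> \<Delta>] (finsert (Neg (Conj \<alpha> \<beta>)) \<Gamma> \<Rrightarrow> \<Delta>)"
| neg_conj_right:
    "TS4_common [finsert \<alpha> (finsert \<beta> \<Gamma>) \<Rrightarrow> \<Delta>] (\<Gamma> \<Rrightarrow> finsert (Neg (Conj \<alpha> \<beta>)) \<Delta>)"
| neg_disj_left:
    "TS4_common [\<Gamma> \<Rrightarrow> finsert \<alpha> (finsert \<beta> \<Delta>)] (finsert (Neg (Disj \<alpha> \<beta>)) \<Gamma> \<Rrightarrow> \<Delta>)"
| neg_disj_right:
    "TS4_common [finsert \<alpha> \<Gamma> \<Rrightarrow> \<Delta>, finsert \<beta> \<Gamma> \<Rrightarrow> \<Delta>] (\<Gamma> \<Rrightarrow> finsert (Neg (Disj \<alpha> \<beta>)) \<Delta>)"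
| neg_imp_left:
    "TS4_common [finsert \<alpha> \<Gamma> \<Rrightarrow> finsert \<beta> \<Delta>] (finsert (Neg (Imp \<alpha> \<beta>)) \<Gamma> \<Rrightarrow> \<Delta>)"
| neg_imp_right:
    "TS4_common [\<Gamma> \<Rrightarrow> finsert \<alpha> \<Delta>, finsert \<beta> \<Gamma> \<Rrightarrow> \<Delta>] (\<Gamma> \<Rrightarrow> finsert (Neg (Imp \<alpha> \<beta>)) \<Delta>)"
| neg_box_right: "TS4_common [finsert \<alpha> \<Gamma> \<Rrightarrow> \<Delta>] (\<Gamma> \<Rrightarrow> finsert (Neg (Box \<alpha>)) \<Delta>)"
| neg_dia_left: "TS4_common [\<Gamma> \<Rrightarrow> finsert \<alpha> \<Delta>] (finsert (Neg (Dia \<alpha>)) \<Gamma> \<Rrightarrow> \<Delta>)"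

inductive lTS4 :: calculus where
  common: "TS4_common Ss S \<Longrightarrow> lTS4 Ss S"
| box_right:
    "lTS4 [boxes \<Gamma>1 |\<union>| negs (dias \<Gamma>2) \<Rrightarrow> finsert \<alpha> (dias \<Delta>1 |\<union>| negs (boxes \<Delta>2))]
       (boxes \<Gamma>1 |\<union>| negs (dias \<Gamma>2) \<Rrightarrow> finsert (Box \<alpha>) (dias \<Delta>1 |\<union>| negs (boxes \<Delta>2)))"
| dia_left:
    "lTS4 [finsert \<alpha> (boxes \<Gamma>1 |\<union>| negs (dias \<Gamma>2)) \<Rrightarrow> dias \<Delta>1 |\<union>| negs (boxes \<Delta>2)]
       (finsert (Dia \<alpha>) (boxes \<Gamma>1 |\<union>| negs (dias \<Gamma>2)) \<Rrightarrow> dias \<Delta>1 |\<union>| negs (boxes \<Delta>2))"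
| neg_box_left:
    "lTS4 [boxes \<Gamma>1 |\<union>| negs (dias \<Gamma>2) \<Rrightarrow> finsert \<alpha> (dias \<Delta>1 |\<union>| negs (boxes \<Delta>2))]
       (finsert (Neg (Box \<alpha>)) (boxes \<Gamma>1 |\<union>| negs (dias \<Gamma>2)) \<Rrightarrow> dias \<Delta>1 |\<union>| negs (boxes \<Delta>2))"
| neg_dia_right:
    "lTS4 [finsert \<alpha> (boxes \<Gamma>1 |\<union>| negs (dias \<Gamma>2)) \<Rrightarrow> dias \<Delta>1 |\<union>| negs (boxes \<Delta>2)]
       (boxes \<Gamma>1 |\<union>| negs (dias \<Gamma>2) \<Rrightarrow> finsert (Neg (Dia \<alpha>)) (dias \<Delta>1 |\<union>| negs (boxes \<Delta>2)))"

inductive gTS4 :: calculus where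
  common: "TS4_common Ss S \<Longrightarrow> gTS4 Ss S"
| box_right:
    "gTS4 [boxes \<Gamma>1 |\<union>| boxes \<Delta>2 \<Rrightarrow> finsert \<alpha> (dias \<Delta>1 |\<union>| dias \<Gamma>2)]
       (boxes \<Gamma>1 |\<union>| negs (dias \<Gamma>2) \<Rrightarrow> finsert (Box \<alpha>) (dias \<Delta>1 |\<union>| negs (boxes \<Delta>2)))"
| dia_left:
    "gTS4 [finsert \<alpha> (boxes \<Gamma>1 |\<union>| boxes \<Delta>2) \<Rrightarrow> dias \<Delta>1 |\<union>| dias \<Gamma>2]
       (finsert (Dia \<alpha>) (boxes \<Gamma>1 |\<union>| negs (dias \<Gamma>2)) \<Rrightarrow> dias \<Delta>1 |\<union>| negs (boxes \<Delta>2))"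
| neg_box_left:
    "gTS4 [boxes \<Gamma>1 |\<union>| boxes \<Delta>2 \<Rrightarrow> finsert \<alpha> (dias \<Delta>1 |\<union>| dias \<Gamma>2)]
       (finsert (Neg (Box \<alpha>)) (boxes \<Gamma>1 |\<union>| negs (dias \<Gamma>2)) \<Rrightarrow> dias \<Delta>1 |\<union>| negs (boxes \<Delta>2))"
| neg_dia_right:
    "gTS4 [finsert \<alpha> (boxes \<Gamma>1 |\<union>| boxes \<Delta>2) \<Rrightarrow> dias \<Delta>1 |\<union>| dias \<Gamma>2]
       (boxes \<Gamma>1 |\<union>| negs (dias \<Gamma>2) \<Rrightarrow> finsert (Neg (Dia \<alpha>)) (dias \<Delta>1 |\<union>| negs (boxes \<Delta>2)))"

datatype proof_tree = Infer (end_sequent: sequent) (subproofs: "proof_tree list")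

inductive is_proof :: "calculus \<Rightarrow> proof_tree \<Rightarrow> bool" for L :: calculus where
  "L (map end_sequent Ps) S \<Longrightarrow> \<forall>P \<in> set Ps. is_proof L P \<Longrightarrow> is_proof L (Infer S Ps)"

definition proof_of :: "calculus \<Rightarrow> proof_tree \<Rightarrow> sequent \<Rightarrow> bool" where
  "proof_of L P S \<longleftrightarrow> is_proof L P \<and> end_sequent P = S"

definition provable :: "calculus \<Rightarrow> sequent \<Rightarrow> bool" where
  "provable L S \<longleftrightarrow> (\<exists>P. proof_of L P S)"

fun proof_formulas :: "proof_tree \<Rightarrow> fm set" where
  "proof_formulas (Infer S Ps) = sequent_formulas S \<union> (\<Union>P \<in> set Ps. proof_formulas P)"

definition subformula_property :: "calculus \<Rightarrow> bool" where
  "subformula_property L \<longleftrightarrow>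
     (\<forall>S. provable L S \<longrightarrow>
       (\<exists>P. proof_of L P S \<and>
         (\<forall>\<phi> \<in> proof_formulas P. \<exists>\<psi> \<in> sequent_formulas S. \<phi> \<in> subformulas \<psi>)))"

end

theory Submission
  imports Defs
begin

text \<open>
  Negation is classical in both calculi, so every provable sequent is valid in all reflexive and
  transitive Kripke models. Conversely, let \<open>F\<close> be the set of subformulas of a sequent that has no
  derivation inside \<open>F\<close>. The underivable sequents over \<open>F\<close> that are maximal under inclusion
  are the worlds of a countermodel, in which a world sees those worlds that inherit its boxed
  antecedent formulas and its diamond succedent formulas, where \<open>\<not>\<box>\<beta>\<close> on the right counts as
  \<open>\<box>\<beta>\<close> on the left and \<open>\<not>\<diamond>\<beta>\<close> on the left as \<open>\<diamond>\<beta>\<close> on the right. With this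
  accessibility relation one construction serves both calculi.
\<close>

section \<open>Kripke semantics\<close>

primrec holds :: "('w \<Rightarrow> 'w \<Rightarrow> bool) \<Rightarrow> (nat \<Rightarrow> 'w \<Rightarrow> bool) \<Rightarrow> 'w \<Rightarrow> fm \<Rightarrow> bool" where
  "holds R V w (Var p) \<longleftrightarrow> V p w"
| "holds R V w (Conj \<alpha> \<beta>) \<longleftrightarrow> holds R V w \<alpha> \<and> holds R V w \<beta>"
| "holds R V w (Disj \<alpha> \<beta>) \<longleftrightarrow> holds R V w \<alpha> \<or> holds R V w \<beta>"
| "holds R V w (Imp \<alpha> \<beta>) \<longleftrightarrow> (holds R V w \<alpha> \<longrightarrow> holds R V w \<beta>)"
| "holds R V w (Neg \<alpha>) \<longleftrightarrow> \<not> holds R V w \<alpha>"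
| "holds R V w (Box \<alpha>) \<longleftrightarrow> (\<forall>v. R w v \<longrightarrow> holds R V v \<alpha>)"
| "holds R V w (Dia \<alpha>) \<longleftrightarrow> (\<exists>v. R w v \<and> holds R V v \<alpha>)"

definition refutes :: "('w \<Rightarrow> 'w \<Rightarrow> bool) \<Rightarrow> (nat \<Rightarrow> 'w \<Rightarrow> bool) \<Rightarrow> 'w \<Rightarrow> fm fset \<Rightarrow> fm fset \<Rightarrow> bool" where
  "refutes R V w \<Gamma> \<Delta> \<longleftrightarrow>
     (\<forall>\<phi> \<in> fset \<Gamma>. holds R V w \<phi>) \<and> (\<forall>\<psi> \<in> fset \<Delta>. \<not> holds R V w \<psi>)"

lemma refutes_finsert [simp]:
  "refutes R V w (finsert \<alpha> \<Gamma>) \<Delta> \<longleftrightarrow> holds R V w \<alpha> \<and> refutes R V w \<Gamma> \<Delta>"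
  "refutes R V w \<Gamma> (finsert \<alpha> \<Delta>) \<longleftrightarrow> \<not> holds R V w \<alpha> \<and> refutes R V w \<Gamma> \<Delta>"
  by (auto simp: refutes_def)

primrec valid_in :: "('w \<Rightarrow> 'w \<Rightarrow> bool) \<Rightarrow> (nat \<Rightarrow> 'w \<Rightarrow> bool) \<Rightarrow> sequent \<Rightarrow> bool" where
  "valid_in R V (\<Gamma> \<Rrightarrow> \<Delta>) \<longleftrightarrow> (\<forall>w. \<not> refutes R V w \<Gamma> \<Delta>)"

section \<open>Soundness over reflexive transitive models\<close>

lemma TS4_common_sound:
  assumes "TS4_common Ss S" and "reflp R" and "\<forall>T \<in> set Ss. valid_in R V T"
  shows "valid_in R V S"
  using assms(1,3)
proof induction
  case (cut \<Gamma> \<alpha> \<Delta>)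
  then show ?case by (auto simp: refutes_def)
next
  \<comment> \<open>Reflexivity enters here and in the next three cases, where a modality is dropped
    in an arbitrary context without leaving the world. The other rules are propositional at each
    world, as negation is classical.\<close>
  case (box_left \<alpha> \<Gamma> \<Delta>)
  then show ?case using reflpD[OF assms(2)] by auto
next
  case (dia_right \<Gamma> \<alpha> \<Delta>)
  then show ?case using reflpD[OF assms(2)] by auto
next
  case (neg_box_right \<alpha> \<Gamma> \<Delta>)
  then show ?case using reflpD[OF assms(2)] by auto
next
  case (neg_dia_left \<Gamma> \<alpha> \<Delta>)
  then show ?case using reflpD[OF assms(2)] by auto
qed auto

text \<open>A world refuting the conclusion has a successor that gives \<alpha> the wrong truth
  value, and the assumption carries the context there. Premise and conclusion have separate
  contexts, so the lemma covers the modal rules of both calculi.\<close>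

lemma modal_rules_sound:
  assumes "\<And>w v. R w v \<Longrightarrow> refutes R V w \<Gamma> \<Delta> \<Longrightarrow> refutes R V v \<Gamma>' \<Delta>'"
  shows "valid_in R V (\<Gamma>' \<Rrightarrow> finsert \<alpha> \<Delta>') \<Longrightarrow> valid_in R V (\<Gamma> \<Rrightarrow> finsert (Box \<alpha>) \<Delta>)"
    and "valid_in R V (finsert \<alpha> \<Gamma>' \<Rrightarrow> \<Delta>') \<Longrightarrow> valid_in R V (finsert (Dia \<alpha>) \<Gamma> \<Rrightarrow> \<Delta>)"
    and "valid_in R V (\<Gamma>' \<Rrightarrow> finsert \<alpha> \<Delta>') \<Longrightarrow> valid_in R V (finsert (Neg (Box \<alpha>)) \<Gamma> \<Rrightarrow> \<Delta>)"
    and "valid_in R V (finsert \<alpha> \<Gamma>' \<Rrightarrow> \<Delta>') \<Longrightarrow> valid_in R V (\<Gamma> \<Rrightarrow> finsert (Neg (Dia \<alpha>)) \<Delta>)"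
  using assms by auto

text \<open>By transitivity a true box stays true and a false diamond stays false at successors. A
  negated diamond on the left is a false diamond and a negated box on the right a true box, so the
  context may also be carried along with its negations moved across the arrow, as in the premises of
  gTS4.\<close>

lemma refutes_persistent:
  assumes "transp R" and "R w v"
    and "refutes R V w (boxes \<Gamma>1 |\<union>| negs (dias \<Gamma>2)) (dias \<Delta>1 |\<union>| negs (boxes \<Delta>2))"
  shows "refutes R V v (boxes \<Gamma>1 |\<union>| negs (dias \<Gamma>2)) (dias \<Delta>1 |\<union>| negs (boxes \<Delta>2))"
    and "refutes R V v (boxes \<Gamma>1 |\<union>| boxes \<Delta>2) (dias \<Delta>1 |\<union>| dias \<Gamma>2)"
  using assms(3) transpD[OF assms(1,2)] by (simp add: refutes_def ball_Un; blast)+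

lemma lTS4_sound:
  assumes "lTS4 Ss S" and "reflp R" and "transp R" and "\<forall>T \<in> set Ss. valid_in R V T"
  shows "valid_in R V S"
  using assms(1)
proof cases
  case common
  then show ?thesis using TS4_common_sound assms by blast
next
  case box_right
  show ?thesis
    unfolding box_right(2)
    \<comment> \<open>The premise context is still schematic and is instantiated by the persistence
      fact, whose first part leaves the context unchanged. \<open>valid_in\<close> stays folded so
      that the premise is matched as a whole.\<close>
    by (rule modal_rules_sound(1), erule (1) refutes_persistent(1)[OF assms(3)])
      (use assms(4) box_right(1) in \<open>simp del: valid_in.simps\<close>)
next
  case dia_left
  show ?thesis
    unfolding dia_left(2)
    by (rule modal_rules_sound(2), erule (1) refutes_persistent(1)[OF assms(3)])
      (use assms(4) dia_left(1) in \<open>simp del: valid_in.simps\<close>)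
next
  case neg_box_left
  show ?thesis
    unfolding neg_box_left(2)
    by (rule modal_rules_sound(3), erule (1) refutes_persistent(1)[OF assms(3)])
      (use assms(4) neg_box_left(1) in \<open>simp del: valid_in.simps\<close>)
next
  case neg_dia_right
  show ?thesis
    unfolding neg_dia_right(2)
    by (rule modal_rules_sound(4), erule (1) refutes_persistent(1)[OF assms(3)])
      (use assms(4) neg_dia_right(1) in \<open>simp del: valid_in.simps\<close>)
qed

text \<open>The second part of \<open>refutes_persistent\<close> supplies the changed contexts of
  the premises; otherwise the argument is that for \<open>lTS4\<close>.\<close>

lemma gTS4_sound:
  assumes "gTS4 Ss S" and "reflp R" and "transp R" and "\<forall>T \<in> set Ss. valid_in R V T"
  shows "valid_in R V S"
  using assms(1)
proof cases
  case common
  then show ?thesis using TS4_common_sound assms by blast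
next
  case box_right
  show ?thesis
    unfolding box_right(2)
    by (rule modal_rules_sound(1), erule (1) refutes_persistent(2)[OF assms(3)])
      (use assms(4) box_right(1) in \<open>simp del: valid_in.simps\<close>)
next
  case dia_left
  show ?thesis
    unfolding dia_left(2)
    by (rule modal_rules_sound(2), erule (1) refutes_persistent(2)[OF assms(3)])
      (use assms(4) dia_left(1) in \<open>simp del: valid_in.simps\<close>)
next
  case neg_box_left
  show ?thesis
    unfolding neg_box_left(2)
    by (rule modal_rules_sound(3), erule (1) refutes_persistent(2)[OF assms(3)])
      (use assms(4) neg_box_left(1) in \<open>simp del: valid_in.simps\<close>)
next
  case neg_dia_right
  show ?thesis
    unfolding neg_dia_right(2)
    by (rule modal_rules_sound(4), erule (1) refutes_persistent(2)[OF assms(3)])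
      (use assms(4) neg_dia_right(1) in \<open>simp del: valid_in.simps\<close>)
qed

lemma is_proof_sound:
  assumes "is_proof L P"
    and "\<And>Ss S. L Ss S \<Longrightarrow> \<forall>T \<in> set Ss. valid_in R V T \<Longrightarrow> valid_in R V S"
  shows "valid_in R V (end_sequent P)"
  using assms(1)
proof induction
  case (1 Ps S)
  then show ?case using assms(2)[of "map end_sequent Ps" S] by simp
qed

section \<open>Derivations inside a set of formulas\<close>

text \<open>Existence of a proof tree with all formulas in \<open>F\<close>, phrased on sequents so
  that trees can be left aside until the end. The condition on the conclusion of each step reaches
  the premises because they are derived in the same sense.\<close>

inductive deriv :: "calculus \<Rightarrow> fm set \<Rightarrow> sequent \<Rightarrow> bool" for L F where
  derivI: "L Ss S \<Longrightarrow> \<forall>T \<in> set Ss. deriv L F T \<Longrightarrow> sequent_formulas S \<subseteq> F \<Longrightarrow> deriv L F S"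

lemma deriv_imp_proof:
  assumes "deriv L F S"
  shows "\<exists>P. proof_of L P S \<and> proof_formulas P \<subseteq> F"
  using assms
proof induction
  case (derivI Ss S)
  then obtain f where f: "\<forall>T \<in> set Ss. proof_of L (f T) T \<and> proof_formulas (f T) \<subseteq> F"
    by metis
  let ?P = "Infer S (map f Ss)"
  have "map end_sequent (map f Ss) = Ss"
    using f by (simp add: proof_of_def map_idI)
  then have "is_proof L ?P"
    using f derivI.hyps(1) by (intro is_proof.intros) (auto simp: proof_of_def)
  moreover have "proof_formulas ?P \<subseteq> F"
    using f derivI.hyps by auto
  ultimately show ?case
    by (intro exI[of _ ?P]) (simp add: proof_of_def)
qed

section \<open>Maximal underivable sequents\<close>

definition saturated :: "calculus \<Rightarrow> fm set \<Rightarrow> fm fset \<Rightarrow> fm fset \<Rightarrow> bool" where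
  "saturated L F \<Gamma> \<Delta> \<longleftrightarrow>
     fset \<Gamma> \<subseteq> F \<and> fset \<Delta> \<subseteq> F \<and> \<not> deriv L F (\<Gamma> \<Rrightarrow> \<Delta>) \<and>
     (\<forall>\<Gamma>' \<Delta>'. \<Gamma> |\<subseteq>| \<Gamma>' \<longrightarrow> \<Delta> |\<subseteq>| \<Delta>' \<longrightarrow> fset \<Gamma>' \<subseteq> F \<longrightarrow> fset \<Delta>' \<subseteq> F \<longrightarrow>
        \<not> deriv L F (\<Gamma>' \<Rrightarrow> \<Delta>') \<longrightarrow> \<Gamma>' = \<Gamma> \<and> \<Delta>' = \<Delta>)"

text \<open>Among the underivable extensions over \<open>F\<close>, whose size is bounded because
  \<open>F\<close> is finite, one of greatest total size is taken. Anything underivable above it has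
  the same size on each side and hence coincides with it.\<close>

lemma saturated_extension:
  assumes "finite F" and "fset \<Gamma> \<subseteq> F" and "fset \<Delta> \<subseteq> F" and "\<not> deriv L F (\<Gamma> \<Rrightarrow> \<Delta>)"
  shows "\<exists>\<Gamma>' \<Delta>'. \<Gamma> |\<subseteq>| \<Gamma>' \<and> \<Delta> |\<subseteq>| \<Delta>' \<and> saturated L F \<Gamma>' \<Delta>'"
proof -
  define Q where "Q = (\<lambda>(\<Gamma>', \<Delta>'). \<Gamma> |\<subseteq>| \<Gamma>' \<and> \<Delta> |\<subseteq>| \<Delta>' \<and> fset \<Gamma>' \<subseteq> F \<and> fset \<Delta>' \<subseteq> F \<and>
    \<not> deriv L F (\<Gamma>' \<Rrightarrow> \<Delta>'))"
  define m where "m = (\<lambda>(\<Gamma>' :: fm fset, \<Delta>' :: fm fset). fcard \<Gamma>' + fcard \<Delta>')"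
  have "Q (\<Gamma>, \<Delta>)"
    using assms by (simp add: Q_def)
  moreover have "m x < Suc (card F + card F)" if "Q x" for x
    using that card_mono[OF assms(1)]
    by (auto simp: Q_def m_def fcard.rep_eq less_Suc_eq_le intro!: add_mono split: prod.splits)
  ultimately obtain x where x: "Q x" "\<And>y. Q y \<Longrightarrow> m y \<le> m x"
    using ex_has_greatest_nat[of Q "(\<Gamma>, \<Delta>)" m] by metis
  obtain \<Gamma>1 \<Delta>1 where x_eq: "x = (\<Gamma>1, \<Delta>1)"
    by force
  have "\<Gamma>' = \<Gamma>1 \<and> \<Delta>' = \<Delta>1"
    if "\<Gamma>1 |\<subseteq>| \<Gamma>'" "\<Delta>1 |\<subseteq>| \<Delta>'" "fset \<Gamma>' \<subseteq> F" "fset \<Delta>' \<subseteq> F" "\<not> deriv L F (\<Gamma>' \<Rrightarrow> \<Delta>')"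
    for \<Gamma>' \<Delta>'
  proof -
    have "fcard \<Gamma>' + fcard \<Delta>' \<le> fcard \<Gamma>1 + fcard \<Delta>1"
      using that x(1) x(2)[of "(\<Gamma>', \<Delta>')"] by (auto simp: Q_def m_def x_eq)
    moreover have "fcard \<Gamma>1 \<le> fcard \<Gamma>'" "fcard \<Delta>1 \<le> fcard \<Delta>'"
      using that by (simp_all add: fcard_mono)
    ultimately show ?thesis
      using that fcard_seteq[of \<Gamma>1 \<Gamma>'] fcard_seteq[of \<Delta>1 \<Delta>'] by simp
  qed
  then show ?thesis
    using x(1) unfolding Q_def x_eq saturated_def
    by (intro exI[of _ \<Gamma>1] exI[of _ \<Delta>1]) simp
qed

text \<open>At a saturated sequent these are the formulas forced to be true at every accessible
  world; those in \<open>neg_dias\<close> are forced to be false there. Counting the negated forms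
  on the opposite side makes both sets insensitive to the moves across the arrow in the modal rules
  of gTS4.\<close>

definition pos_boxes :: "fm fset \<Rightarrow> fm fset \<Rightarrow> fm set" where
  "pos_boxes \<Gamma> \<Delta> = {\<beta>. Box \<beta> |\<in>| \<Gamma> \<or> Neg (Box \<beta>) |\<in>| \<Delta>}"

definition neg_dias :: "fm fset \<Rightarrow> fm fset \<Rightarrow> fm set" where
  "neg_dias \<Gamma> \<Delta> = {\<beta>. Dia \<beta> |\<in>| \<Delta> \<or> Neg (Dia \<beta>) |\<in>| \<Gamma>}"

lemma finite_constructor_preimage:
  assumes "inj c"
  shows "\<exists>\<Sigma>. \<forall>\<beta>. \<beta> |\<in>| \<Sigma> \<longleftrightarrow> c \<beta> |\<in>| \<Gamma>"
proof -
  have "finite {\<beta>. c \<beta> |\<in>| \<Gamma>}"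
    using finite_vimageI[OF finite_fset assms, of \<Gamma>] by (simp add: vimage_def)
  then show ?thesis
    by (intro exI[of _ "Abs_fset {\<beta>. c \<beta> |\<in>| \<Gamma>}"]) (simp add: Abs_fset_inverse)
qed

text \<open>These are the largest context parameters for which the context of a modal rule still
  lies within the given sequent. With them no box or diamond information is lost on passing to the
  premise.\<close>

lemma modal_parts:
  obtains \<Gamma>1 \<Gamma>2 \<Delta>1 \<Delta>2 where
    "\<And>\<beta>. \<beta> |\<in>| \<Gamma>1 \<longleftrightarrow> Box \<beta> |\<in>| \<Gamma>" "\<And>\<beta>. \<beta> |\<in>| \<Gamma>2 \<longleftrightarrow> Neg (Dia \<beta>) |\<in>| \<Gamma>"
    "\<And>\<beta>. \<beta> |\<in>| \<Delta>1 \<longleftrightarrow> Dia \<beta> |\<in>| \<Delta>" "\<And>\<beta>. \<beta> |\<in>| \<Delta>2 \<longleftrightarrow> Neg (Box \<beta>) |\<in>| \<Delta>"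
  using finite_constructor_preimage[of Box \<Gamma>] finite_constructor_preimage[of "\<lambda>\<beta>. Neg (Dia \<beta>)" \<Gamma>]
    finite_constructor_preimage[of Dia \<Delta>] finite_constructor_preimage[of "\<lambda>\<beta>. Neg (Box \<beta>)" \<Delta>]
  by (auto simp: inj_def)

section \<open>Subformula closure and weakening\<close>

lemma self_subformula: "\<phi> \<in> subformulas \<phi>"
  by (cases \<phi>) auto

lemma subformulas_trans: "\<phi> \<in> subformulas \<psi> \<Longrightarrow> subformulas \<phi> \<subseteq> subformulas \<psi>"
  by (induction \<psi>) auto

lemma finite_subformulas: "finite (subformulas \<phi>)"
  by (induction \<phi>) auto

text \<open>Collects what follows from the common rules alone, whatever further rules
  \<open>L\<close> has. Closure of \<open>F\<close> keeps the active formulas of the premises inside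
  \<open>F\<close>.\<close>

locale common_extension =
  fixes L :: calculus and F :: "fm set"
  assumes common: "TS4_common Ss S \<Longrightarrow> L Ss S"
    and subformula_closed: "\<phi> \<in> F \<Longrightarrow> subformulas \<phi> \<subseteq> F"
begin

lemma components_in:
  "Conj \<alpha> \<beta> \<in> F \<Longrightarrow> \<alpha> \<in> F \<and> \<beta> \<in> F"
  "Disj \<alpha> \<beta> \<in> F \<Longrightarrow> \<alpha> \<in> F \<and> \<beta> \<in> F"
  "Imp \<alpha> \<beta> \<in> F \<Longrightarrow> \<alpha> \<in> F \<and> \<beta> \<in> F"
  "Neg \<alpha> \<in> F \<Longrightarrow> \<alpha> \<in> F"
  "Box \<alpha> \<in> F \<Longrightarrow> \<alpha> \<in> F"
  "Dia \<alpha> \<in> F \<Longrightarrow> \<alpha> \<in> F"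
  using subformula_closed self_subformula by fastforce+

lemma deriv_common:
  "TS4_common Ss (\<Gamma> \<Rrightarrow> \<Delta>) \<Longrightarrow> \<forall>T \<in> set Ss. deriv L F T \<Longrightarrow> fset \<Gamma> \<subseteq> F \<Longrightarrow> fset \<Delta> \<subseteq> F \<Longrightarrow>
     deriv L F (\<Gamma> \<Rrightarrow> \<Delta>)"
  using derivI[of L Ss "\<Gamma> \<Rrightarrow> \<Delta>" F] common by auto

lemma deriv_in: "deriv L F (\<Gamma> \<Rrightarrow> \<Delta>) \<Longrightarrow> fset \<Gamma> \<subseteq> F \<and> fset \<Delta> \<subseteq> F"
  by (erule deriv.cases) auto

lemma deriv_union:
  assumes "deriv L F (\<Gamma> \<Rrightarrow> \<Delta>)" and "fset \<Gamma>' \<subseteq> F" and "fset \<Delta>' \<subseteq> F"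
  shows "deriv L F (\<Gamma>' |\<union>| \<Gamma> \<Rrightarrow> \<Delta>' |\<union>| \<Delta>)"
proof -
  have "deriv L F (\<Gamma>' |\<union>| \<Gamma> \<Rrightarrow> \<Delta>)"
    using assms(2)
  proof (induction \<Gamma>')
    case empty
    then show ?case using assms(1) by simp
  next
    case (insert \<alpha> \<Sigma>)
    then show ?case
      using deriv_common[OF we_left[of "\<Sigma> |\<union>| \<Gamma>" \<Delta> \<alpha>]] deriv_in[of "\<Sigma> |\<union>| \<Gamma>" \<Delta>] by simp
  qed
  then show ?thesis
    using assms(3)
  proof (induction \<Delta>')
    case empty
    then show ?case by simp
  next
    case (insert \<alpha> \<Sigma>)
    then show ?case
      using deriv_common[OF we_right[of "\<Gamma>' |\<union>| \<Gamma>" "\<Sigma> |\<union>| \<Delta>" \<alpha>]]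
        deriv_in[of "\<Gamma>' |\<union>| \<Gamma>" "\<Sigma> |\<union>| \<Delta>"] by simp
  qed
qed

lemma deriv_weaken:
  assumes "deriv L F (\<Gamma> \<Rrightarrow> \<Delta>)" and "\<Gamma> |\<subseteq>| \<Gamma>'" and "\<Delta> |\<subseteq>| \<Delta>'" and "fset \<Gamma>' \<subseteq> F" and "fset \<Delta>' \<subseteq> F"
  shows "deriv L F (\<Gamma>' \<Rrightarrow> \<Delta>')"
  using deriv_union[OF assms(1,4,5)] assms(2,3) by (simp add: sup.absorb1)

section \<open>Saturation conditions given by the common rules\<close>

context
  fixes \<Gamma> \<Delta>
  assumes sat: "saturated L F \<Gamma> \<Delta>"
begin

lemma saturated_in: "\<phi> |\<in>| \<Gamma> \<Longrightarrow> \<phi> \<in> F" "\<phi> |\<in>| \<Delta> \<Longrightarrow> \<phi> \<in> F"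
  using sat by (auto simp: saturated_def)

lemma saturated_not_deriv: "\<Gamma>' |\<subseteq>| \<Gamma> \<Longrightarrow> \<Delta>' |\<subseteq>| \<Delta> \<Longrightarrow> \<not> deriv L F (\<Gamma>' \<Rrightarrow> \<Delta>')"
  using sat deriv_weaken[of \<Gamma>' \<Delta>' \<Gamma> \<Delta>] by (auto simp: saturated_def)

text \<open>
  In every application below the principal formula already belongs to the context, so that the
  conclusion of the rule is \<^term>\<open>\<Gamma> \<Rrightarrow> \<Delta>\<close> itself.
\<close>

lemma saturated_rule:
  assumes "TS4_common Ss (\<Gamma> \<Rrightarrow> \<Delta>)"
    and "\<forall>T \<in> set Ss. \<exists>\<Gamma>' \<Delta>'. T = (\<Gamma>' \<Rrightarrow> \<Delta>') \<and> \<Gamma> |\<subseteq>| \<Gamma>' \<and> \<Delta> |\<subseteq>| \<Delta>' \<and> fset \<Gamma>' \<subseteq> F \<and> fset \<Delta>' \<subseteq> F"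
  shows "(\<Gamma> \<Rrightarrow> \<Delta>) \<in> set Ss"
\<comment> \<open>Some premise is underivable because the conclusion is. It extends the saturated
  sequent within \<open>F\<close>, so maximality makes the two equal.\<close>
proof -
  obtain T where "T \<in> set Ss" "\<not> deriv L F T"
    using deriv_common[OF assms(1)] sat by (auto simp: saturated_def)
  moreover then obtain \<Gamma>' \<Delta>' where "T = (\<Gamma>' \<Rrightarrow> \<Delta>')" "\<Gamma> |\<subseteq>| \<Gamma>'" "\<Delta> |\<subseteq>| \<Delta>'" "fset \<Gamma>' \<subseteq> F" "fset \<Delta>' \<subseteq> F"
    using assms(2) by blast
  ultimately show ?thesis
    using sat unfolding saturated_def by metis
qed

text \<open>A premise written as the conclusion enlarged by its active formulas can equal the
  conclusion only if these formulas were present already. With two premises, in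
  \<open>saturated_rule2\<close>, this happens for at least one of them.\<close>

lemma saturated_rule1:
  assumes "TS4_common [\<Gamma>1 |\<union>| \<Gamma> \<Rrightarrow> \<Delta>1 |\<union>| \<Delta>] (\<Gamma> \<Rrightarrow> \<Delta>)" and "fset \<Gamma>1 \<subseteq> F" and "fset \<Delta>1 \<subseteq> F"
  shows "\<Gamma>1 |\<subseteq>| \<Gamma> \<and> \<Delta>1 |\<subseteq>| \<Delta>"
proof -
  have "(\<Gamma> \<Rrightarrow> \<Delta>) \<in> set [\<Gamma>1 |\<union>| \<Gamma> \<Rrightarrow> \<Delta>1 |\<union>| \<Delta>]"
    by (rule saturated_rule[OF assms(1)]) (use assms saturated_in in auto)
  then show ?thesis
    by (metis empty_iff empty_set le_iff_sup sequent.inject set_ConsD sup.commute)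
qed

lemma saturated_rule2:
  assumes "TS4_common [\<Gamma>1 |\<union>| \<Gamma> \<Rrightarrow> \<Delta>1 |\<union>| \<Delta>, \<Gamma>2 |\<union>| \<Gamma> \<Rrightarrow> \<Delta>2 |\<union>| \<Delta>] (\<Gamma> \<Rrightarrow> \<Delta>)"
    and "fset \<Gamma>1 \<subseteq> F" and "fset \<Delta>1 \<subseteq> F" and "fset \<Gamma>2 \<subseteq> F" and "fset \<Delta>2 \<subseteq> F"
  shows "\<Gamma>1 |\<subseteq>| \<Gamma> \<and> \<Delta>1 |\<subseteq>| \<Delta> \<or> \<Gamma>2 |\<subseteq>| \<Gamma> \<and> \<Delta>2 |\<subseteq>| \<Delta>"
proof -
  have "(\<Gamma> \<Rrightarrow> \<Delta>) \<in> set [\<Gamma>1 |\<union>| \<Gamma> \<Rrightarrow> \<Delta>1 |\<union>| \<Delta>, \<Gamma>2 |\<union>| \<Gamma> \<Rrightarrow> \<Delta>2 |\<union>| \<Delta>]"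
    by (rule saturated_rule[OF assms(1)]) (use assms saturated_in in auto)
  then show ?thesis
    by (metis empty_iff empty_set le_iff_sup sequent.inject set_ConsD sup.commute)
qed

text \<open>The principal formula is already in \<Gamma>, so \<open>finsert_absorb\<close> turns the
  conclusion of the rule into the saturated sequent; the finite sets passed to
  \<open>saturated_rule1\<close> are the active formulas. The conditions down to
  \<open>saturated_neg_dia_left\<close> arise in the same way, with \<open>saturated_rule2\<close>
  for branching rules.\<close>

lemma saturated_conj_left: "Conj \<alpha> \<beta> |\<in>| \<Gamma> \<Longrightarrow> \<alpha> |\<in>| \<Gamma> \<and> \<beta> |\<in>| \<Gamma>"
  by (frule saturated_in(1))
    (use conj_left[of \<alpha> \<beta> \<Gamma> \<Delta>] saturated_rule1[of "{|\<alpha>, \<beta>|}" "{||}"]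
      in \<open>auto simp: finsert_absorb dest!: components_in\<close>)

lemma saturated_conj_right: "Conj \<alpha> \<beta> |\<in>| \<Delta> \<Longrightarrow> \<alpha> |\<in>| \<Delta> \<or> \<beta> |\<in>| \<Delta>"
  by (frule saturated_in(2))
    (use conj_right[of \<Gamma> \<alpha> \<Delta> \<beta>] saturated_rule2[of "{||}" "{|\<alpha>|}" "{||}" "{|\<beta>|}"]
      in \<open>auto simp: finsert_absorb dest!: components_in\<close>)

lemma saturated_disj_left: "Disj \<alpha> \<beta> |\<in>| \<Gamma> \<Longrightarrow> \<alpha> |\<in>| \<Gamma> \<or> \<beta> |\<in>| \<Gamma>"
  by (frule saturated_in(1))
    (use disj_left[of \<alpha> \<Gamma> \<Delta> \<beta>] saturated_rule2[of "{|\<alpha>|}" "{||}" "{|\<beta>|}" "{||}"]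
      in \<open>auto simp: finsert_absorb dest!: components_in\<close>)

lemma saturated_disj_right: "Disj \<alpha> \<beta> |\<in>| \<Delta> \<Longrightarrow> \<alpha> |\<in>| \<Delta> \<and> \<beta> |\<in>| \<Delta>"
  by (frule saturated_in(2))
    (use disj_right[of \<Gamma> \<alpha> \<beta> \<Delta>] saturated_rule1[of "{||}" "{|\<alpha>, \<beta>|}"]
      in \<open>auto simp: finsert_absorb dest!: components_in\<close>)

lemma saturated_imp_left: "Imp \<alpha> \<beta> |\<in>| \<Gamma> \<Longrightarrow> \<alpha> |\<in>| \<Delta> \<or> \<beta> |\<in>| \<Gamma>"
  by (frule saturated_in(1))
    (use imp_left[of \<Gamma> \<alpha> \<Delta> \<beta>] saturated_rule2[of "{||}" "{|\<alpha>|}" "{|\<beta>|}" "{||}"]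
      in \<open>auto simp: finsert_absorb dest!: components_in\<close>)

lemma saturated_imp_right: "Imp \<alpha> \<beta> |\<in>| \<Delta> \<Longrightarrow> \<alpha> |\<in>| \<Gamma> \<and> \<beta> |\<in>| \<Delta>"
  by (frule saturated_in(2))
    (use imp_right[of \<alpha> \<Gamma> \<beta> \<Delta>] saturated_rule1[of "{|\<alpha>|}" "{|\<beta>|}"]
      in \<open>auto simp: finsert_absorb dest!: components_in\<close>)

lemma saturated_box_left: "Box \<alpha> |\<in>| \<Gamma> \<Longrightarrow> \<alpha> |\<in>| \<Gamma>"
  by (frule saturated_in(1))
    (use box_left[of \<alpha> \<Gamma> \<Delta>] saturated_rule1[of "{|\<alpha>|}" "{||}"]
      in \<open>auto simp: finsert_absorb dest!: components_in\<close>)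

lemma saturated_dia_right: "Dia \<alpha> |\<in>| \<Delta> \<Longrightarrow> \<alpha> |\<in>| \<Delta>"
  by (frule saturated_in(2))
    (use dia_right[of \<Gamma> \<alpha> \<Delta>] saturated_rule1[of "{||}" "{|\<alpha>|}"]
      in \<open>auto simp: finsert_absorb dest!: components_in\<close>)

lemma saturated_neg_neg_left: "Neg (Neg \<alpha>) |\<in>| \<Gamma> \<Longrightarrow> \<alpha> |\<in>| \<Gamma>"
  by (frule saturated_in(1))
    (use neg_neg_left[of \<alpha> \<Gamma> \<Delta>] saturated_rule1[of "{|\<alpha>|}" "{||}"]
      in \<open>auto simp: finsert_absorb dest!: components_in\<close>)

lemma saturated_neg_neg_right: "Neg (Neg \<alpha>) |\<in>| \<Delta> \<Longrightarrow> \<alpha> |\<in>| \<Delta>"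
  by (frule saturated_in(2))
    (use neg_neg_right[of \<Gamma> \<alpha> \<Delta>] saturated_rule1[of "{||}" "{|\<alpha>|}"]
      in \<open>auto simp: finsert_absorb dest!: components_in\<close>)

lemma saturated_neg_conj_left: "Neg (Conj \<alpha> \<beta>) |\<in>| \<Gamma> \<Longrightarrow> \<alpha> |\<in>| \<Delta> \<or> \<beta> |\<in>| \<Delta>"
  by (frule saturated_in(1))
    (use neg_conj_left[of \<Gamma> \<alpha> \<Delta> \<beta>] saturated_rule2[of "{||}" "{|\<alpha>|}" "{||}" "{|\<beta>|}"]
      in \<open>auto simp: finsert_absorb dest!: components_in\<close>)

lemma saturated_neg_conj_right: "Neg (Conj \<alpha> \<beta>) |\<in>| \<Delta> \<Longrightarrow> \<alpha> |\<in>| \<Gamma> \<and> \<beta> |\<in>| \<Gamma>"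
  by (frule saturated_in(2))
    (use neg_conj_right[of \<alpha> \<beta> \<Gamma> \<Delta>] saturated_rule1[of "{|\<alpha>, \<beta>|}" "{||}"]
      in \<open>auto simp: finsert_absorb dest!: components_in\<close>)

lemma saturated_neg_disj_left: "Neg (Disj \<alpha> \<beta>) |\<in>| \<Gamma> \<Longrightarrow> \<alpha> |\<in>| \<Delta> \<and> \<beta> |\<in>| \<Delta>"
  by (frule saturated_in(1))
    (use neg_disj_left[of \<Gamma> \<alpha> \<beta> \<Delta>] saturated_rule1[of "{||}" "{|\<alpha>, \<beta>|}"]
      in \<open>auto simp: finsert_absorb dest!: components_in\<close>)

lemma saturated_neg_disj_right: "Neg (Disj \<alpha> \<beta>) |\<in>| \<Delta> \<Longrightarrow> \<alpha> |\<in>| \<Gamma> \<or> \<beta> |\<in>| \<Gamma>"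
  by (frule saturated_in(2))
    (use neg_disj_right[of \<alpha> \<Gamma> \<Delta> \<beta>] saturated_rule2[of "{|\<alpha>|}" "{||}" "{|\<beta>|}" "{||}"]
      in \<open>auto simp: finsert_absorb dest!: components_in\<close>)

lemma saturated_neg_imp_left: "Neg (Imp \<alpha> \<beta>) |\<in>| \<Gamma> \<Longrightarrow> \<alpha> |\<in>| \<Gamma> \<and> \<beta> |\<in>| \<Delta>"
  by (frule saturated_in(1))
    (use neg_imp_left[of \<alpha> \<Gamma> \<beta> \<Delta>] saturated_rule1[of "{|\<alpha>|}" "{|\<beta>|}"]
      in \<open>auto simp: finsert_absorb dest!: components_in\<close>)

lemma saturated_neg_imp_right: "Neg (Imp \<alpha> \<beta>) |\<in>| \<Delta> \<Longrightarrow> \<alpha> |\<in>| \<Delta> \<or> \<beta> |\<in>| \<Gamma>"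
  by (frule saturated_in(2))
    (use neg_imp_right[of \<Gamma> \<alpha> \<Delta> \<beta>] saturated_rule2[of "{||}" "{|\<alpha>|}" "{|\<beta>|}" "{||}"]
      in \<open>auto simp: finsert_absorb dest!: components_in\<close>)

lemma saturated_neg_box_right: "Neg (Box \<alpha>) |\<in>| \<Delta> \<Longrightarrow> \<alpha> |\<in>| \<Gamma>"
  by (frule saturated_in(2))
    (use neg_box_right[of \<alpha> \<Gamma> \<Delta>] saturated_rule1[of "{|\<alpha>|}" "{||}"]
      in \<open>auto simp: finsert_absorb dest!: components_in\<close>)

lemma saturated_neg_dia_left: "Neg (Dia \<alpha>) |\<in>| \<Gamma> \<Longrightarrow> \<alpha> |\<in>| \<Delta>"
  by (frule saturated_in(1))
    (use neg_dia_left[of \<Gamma> \<alpha> \<Delta>] saturated_rule1[of "{||}" "{|\<alpha>|}"]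
      in \<open>auto simp: finsert_absorb dest!: components_in\<close>)

text \<open>Otherwise one of the four initial sequents would be a derivable part of the saturated
  sequent. Together the four cases say that no variable is forced both true and false.\<close>

lemma saturated_Var:
  shows "Var p |\<in>| \<Gamma> \<Longrightarrow> Var p |\<notin>| \<Delta>" and "Var p |\<in>| \<Gamma> \<Longrightarrow> Neg (Var p) |\<notin>| \<Gamma>"
    and "Neg (Var p) |\<in>| \<Delta> \<Longrightarrow> Var p |\<notin>| \<Delta>" and "Neg (Var p) |\<in>| \<Delta> \<Longrightarrow> Neg (Var p) |\<notin>| \<Gamma>"
  using deriv_common[OF init_pos[of p]] saturated_not_deriv[of "{|Var p|}" "{|Var p|}"]
    deriv_common[OF init_neg[of p]] saturated_not_deriv[of "{|Neg (Var p)|}" "{|Neg (Var p)|}"]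
    deriv_common[OF init_left[of p]] saturated_not_deriv[of "{|Neg (Var p), Var p|}" "{||}"]
    deriv_common[OF init_right[of p]] saturated_not_deriv[of "{||}" "{|Neg (Var p), Var p|}"]
    saturated_in
  by auto

end

end

section \<open>The countermodel of saturated sequents\<close>

text \<open>The two steps isolate what is required of the four modal rules with restricted context,
  in which the calculi differ. They ask only for an underivable sequent that keeps the modal
  information; \<open>saturated_extension\<close> then turns it into a world.\<close>

locale analytic_calculus = common_extension +
  assumes finite_formulas: "finite F"
    and box_step: "saturated L F \<Gamma> \<Delta> \<Longrightarrow> Box \<alpha> |\<in>| \<Delta> \<or> Neg (Box \<alpha>) |\<in>| \<Gamma> \<Longrightarrow>
      \<exists>\<Gamma>' \<Delta>'. fset \<Gamma>' \<subseteq> F \<and> fset \<Delta>' \<subseteq> F \<and> \<not> deriv L F (\<Gamma>' \<Rrightarrow> \<Delta>') \<and> \<alpha> |\<in>| \<Delta>' \<and>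
        pos_boxes \<Gamma> \<Delta> \<subseteq> pos_boxes \<Gamma>' \<Delta>' \<and> neg_dias \<Gamma> \<Delta> \<subseteq> neg_dias \<Gamma>' \<Delta>'"
    and dia_step: "saturated L F \<Gamma> \<Delta> \<Longrightarrow> Dia \<alpha> |\<in>| \<Gamma> \<or> Neg (Dia \<alpha>) |\<in>| \<Delta> \<Longrightarrow>
      \<exists>\<Gamma>' \<Delta>'. fset \<Gamma>' \<subseteq> F \<and> fset \<Delta>' \<subseteq> F \<and> \<not> deriv L F (\<Gamma>' \<Rrightarrow> \<Delta>') \<and> \<alpha> |\<in>| \<Gamma>' \<and>
        pos_boxes \<Gamma> \<Delta> \<subseteq> pos_boxes \<Gamma>' \<Delta>' \<and> neg_dias \<Gamma> \<Delta> \<subseteq> neg_dias \<Gamma>' \<Delta>'"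
begin

text \<open>
  Worlds range over the whole type; an unsaturated one is accessible only from itself, which
  keeps the relation reflexive.
\<close>

definition acc :: "fm fset \<times> fm fset \<Rightarrow> fm fset \<times> fm fset \<Rightarrow> bool" where
  "acc w v \<longleftrightarrow> w = v \<or> saturated L F (fst v) (snd v) \<and>
     pos_boxes (fst w) (snd w) \<subseteq> pos_boxes (fst v) (snd v) \<and>
     neg_dias (fst w) (snd w) \<subseteq> neg_dias (fst v) (snd v)"

text \<open>No rule decomposes a negated variable, so its occurrence on the right has to make the
  variable true directly.\<close>

definition val :: "nat \<Rightarrow> fm fset \<times> fm fset \<Rightarrow> bool" where
  "val p w \<longleftrightarrow> Var p |\<in>| fst w \<or> Neg (Var p) |\<in>| snd w"

lemma reflp_acc: "reflp acc"
  by (simp add: reflp_def acc_def)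

lemma transp_acc: "transp acc"
  unfolding transp_def acc_def by blast

lemma acc_saturated:
  assumes "saturated L F \<Gamma> \<Delta>" and "acc (\<Gamma>, \<Delta>) v"
  obtains \<Gamma>' \<Delta>' where "v = (\<Gamma>', \<Delta>')" "saturated L F \<Gamma>' \<Delta>'"
    "pos_boxes \<Gamma> \<Delta> \<subseteq> pos_boxes \<Gamma>' \<Delta>'" "neg_dias \<Gamma> \<Delta> \<subseteq> neg_dias \<Gamma>' \<Delta>'"
  using assms by (cases v) (auto simp: acc_def)

lemma modal_mono:
  assumes "\<Gamma> |\<subseteq>| \<Gamma>'" and "\<Delta> |\<subseteq>| \<Delta>'"
  shows "pos_boxes \<Gamma> \<Delta> \<subseteq> pos_boxes \<Gamma>' \<Delta>'" and "neg_dias \<Gamma> \<Delta> \<subseteq> neg_dias \<Gamma>' \<Delta>'"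
  using assms by (auto simp: pos_boxes_def neg_dias_def)

text \<open>The sequent from \<open>box_step\<close> is extended to a saturated one; enlarging it
  only enlarges its modal information, so accessibility is preserved.\<close>

lemma box_successor:
  assumes "saturated L F \<Gamma> \<Delta>" and "Box \<alpha> |\<in>| \<Delta> \<or> Neg (Box \<alpha>) |\<in>| \<Gamma>"
  shows "\<exists>\<Gamma>' \<Delta>'. acc (\<Gamma>, \<Delta>) (\<Gamma>', \<Delta>') \<and> saturated L F \<Gamma>' \<Delta>' \<and> \<alpha> |\<in>| \<Delta>'"
proof -
  obtain \<Gamma>1 \<Delta>1 where 1: "fset \<Gamma>1 \<subseteq> F" "fset \<Delta>1 \<subseteq> F" "\<not> deriv L F (\<Gamma>1 \<Rrightarrow> \<Delta>1)" "\<alpha> |\<in>| \<Delta>1"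
    "pos_boxes \<Gamma> \<Delta> \<subseteq> pos_boxes \<Gamma>1 \<Delta>1" "neg_dias \<Gamma> \<Delta> \<subseteq> neg_dias \<Gamma>1 \<Delta>1"
    using box_step[OF assms] by blast
  obtain \<Gamma>' \<Delta>' where "\<Gamma>1 |\<subseteq>| \<Gamma>'" "\<Delta>1 |\<subseteq>| \<Delta>'" "saturated L F \<Gamma>' \<Delta>'"
    using saturated_extension[OF finite_formulas 1(1-3)] by blast
  then show ?thesis
    using 1 modal_mono[of \<Gamma>1 \<Gamma>' \<Delta>1 \<Delta>'] unfolding acc_def
    by (intro exI[of _ \<Gamma>'] exI[of _ \<Delta>']) auto
qed

lemma dia_successor:
  assumes "saturated L F \<Gamma> \<Delta>" and "Dia \<alpha> |\<in>| \<Gamma> \<or> Neg (Dia \<alpha>) |\<in>| \<Delta>"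
  shows "\<exists>\<Gamma>' \<Delta>'. acc (\<Gamma>, \<Delta>) (\<Gamma>', \<Delta>') \<and> saturated L F \<Gamma>' \<Delta>' \<and> \<alpha> |\<in>| \<Gamma>'"
proof -
  obtain \<Gamma>1 \<Delta>1 where 1: "fset \<Gamma>1 \<subseteq> F" "fset \<Delta>1 \<subseteq> F" "\<not> deriv L F (\<Gamma>1 \<Rrightarrow> \<Delta>1)" "\<alpha> |\<in>| \<Gamma>1"
    "pos_boxes \<Gamma> \<Delta> \<subseteq> pos_boxes \<Gamma>1 \<Delta>1" "neg_dias \<Gamma> \<Delta> \<subseteq> neg_dias \<Gamma>1 \<Delta>1"
    using dia_step[OF assms] by blast
  obtain \<Gamma>' \<Delta>' where "\<Gamma>1 |\<subseteq>| \<Gamma>'" "\<Delta>1 |\<subseteq>| \<Delta>'" "saturated L F \<Gamma>' \<Delta>'"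
    using saturated_extension[OF finite_formulas 1(1-3)] by blast
  then show ?thesis
    using 1 modal_mono[of \<Gamma>1 \<Gamma>' \<Delta>1 \<Delta>'] unfolding acc_def
    by (intro exI[of _ \<Gamma>'] exI[of _ \<Delta>']) auto
qed

text \<open>The induction treats \<phi> together with its negation on the opposite side, because the
  twist rules decompose a negated formula directly into the components of \<phi>.\<close>

lemma truth:
  assumes "saturated L F \<Gamma> \<Delta>"
  shows "(\<phi> |\<in>| \<Gamma> \<or> Neg \<phi> |\<in>| \<Delta> \<longrightarrow> holds acc val (\<Gamma>, \<Delta>) \<phi>) \<and>
    (\<phi> |\<in>| \<Delta> \<or> Neg \<phi> |\<in>| \<Gamma> \<longrightarrow> \<not> holds acc val (\<Gamma>, \<Delta>) \<phi>)"
  using assms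
proof (induction \<phi> arbitrary: \<Gamma> \<Delta>)
  case (Var p)
  then show ?case using saturated_Var[OF Var] by (auto simp: val_def)
next
  case (Conj \<alpha> \<beta>)
  show ?case
    using Conj.IH[OF Conj.prems] saturated_conj_left[OF Conj.prems] saturated_conj_right[OF Conj.prems]
      saturated_neg_conj_left[OF Conj.prems] saturated_neg_conj_right[OF Conj.prems]
    by (metis holds.simps(2))
next
  case (Disj \<alpha> \<beta>)
  show ?case
    using Disj.IH[OF Disj.prems] saturated_disj_left[OF Disj.prems] saturated_disj_right[OF Disj.prems]
      saturated_neg_disj_left[OF Disj.prems] saturated_neg_disj_right[OF Disj.prems]
    by (metis holds.simps(3))
next
  case (Imp \<alpha> \<beta>)
  show ?case
    using Imp.IH[OF Imp.prems] saturated_imp_left[OF Imp.prems] saturated_imp_right[OF Imp.prems]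
      saturated_neg_imp_left[OF Imp.prems] saturated_neg_imp_right[OF Imp.prems]
    by (metis holds.simps(4))
next
  case (Neg \<alpha>)
  show ?case
    using Neg.IH[OF Neg.prems] saturated_neg_neg_left[OF Neg.prems] saturated_neg_neg_right[OF Neg.prems]
    by (metis holds.simps(5))
next
  case (Box \<alpha>)
  have "holds acc val v \<alpha>" if v: "acc (\<Gamma>, \<Delta>) v" and "\<alpha> \<in> pos_boxes \<Gamma> \<Delta>" for v
  proof -
    obtain \<Gamma>' \<Delta>' where v_eq: "v = (\<Gamma>', \<Delta>')" and sat: "saturated L F \<Gamma>' \<Delta>'"
      and "pos_boxes \<Gamma> \<Delta> \<subseteq> pos_boxes \<Gamma>' \<Delta>'"
      using acc_saturated[OF Box.prems v] by metis
    \<comment> \<open>Accessibility only transfers the modal information; the conditions of the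
      saturated sequent at \<open>v\<close> itself then put \<alpha> on its left.\<close>
    then have "\<alpha> |\<in>| \<Gamma>'"
      using that saturated_box_left[OF sat] saturated_neg_box_right[OF sat]
      by (auto simp: pos_boxes_def)
    then show ?thesis using Box.IH[OF sat] v_eq by simp
  qed
  moreover have "\<exists>v. acc (\<Gamma>, \<Delta>) v \<and> \<not> holds acc val v \<alpha>"
    if "Box \<alpha> |\<in>| \<Delta> \<or> Neg (Box \<alpha>) |\<in>| \<Gamma>"
    using box_successor[OF Box.prems that] Box.IH by blast
  ultimately show ?case
    by (auto simp: pos_boxes_def)
next
  case (Dia \<alpha>)
  have "\<not> holds acc val v \<alpha>" if v: "acc (\<Gamma>, \<Delta>) v" and "\<alpha> \<in> neg_dias \<Gamma> \<Delta>" for v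
  proof -
    obtain \<Gamma>' \<Delta>' where v_eq: "v = (\<Gamma>', \<Delta>')" and sat: "saturated L F \<Gamma>' \<Delta>'"
      and "neg_dias \<Gamma> \<Delta> \<subseteq> neg_dias \<Gamma>' \<Delta>'"
      using acc_saturated[OF Dia.prems v] by metis
    then have "\<alpha> |\<in>| \<Delta>'"
      using that saturated_dia_right[OF sat] saturated_neg_dia_left[OF sat]
      by (auto simp: neg_dias_def)
    then show ?thesis using Dia.IH[OF sat] v_eq by simp
  qed
  moreover have "\<exists>v. acc (\<Gamma>, \<Delta>) v \<and> holds acc val v \<alpha>"
    if "Dia \<alpha> |\<in>| \<Gamma> \<or> Neg (Dia \<alpha>) |\<in>| \<Delta>"
    using dia_successor[OF Dia.prems that] Dia.IH by blast
  ultimately show ?case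
    by (auto simp: neg_dias_def)
qed

lemma complete:
  assumes "fset \<Gamma> \<subseteq> F" and "fset \<Delta> \<subseteq> F" and valid: "valid_in acc val (\<Gamma> \<Rrightarrow> \<Delta>)"
  shows "deriv L F (\<Gamma> \<Rrightarrow> \<Delta>)"
proof (rule ccontr)
  assume "\<not> deriv L F (\<Gamma> \<Rrightarrow> \<Delta>)"
  then obtain \<Gamma>' \<Delta>' where ext: "\<Gamma> |\<subseteq>| \<Gamma>'" "\<Delta> |\<subseteq>| \<Delta>'" "saturated L F \<Gamma>' \<Delta>'"
    using saturated_extension[OF finite_formulas assms(1,2)] by blast
  then have "refutes acc val (\<Gamma>', \<Delta>') \<Gamma> \<Delta>"
    using truth[OF ext(3)] unfolding refutes_def by blast
  then show False
    using valid by auto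
qed

end

section \<open>Successor steps from the modal rules of each calculus\<close>

lemma lTS4_analytic:
  assumes "finite F" and "\<And>\<phi>. \<phi> \<in> F \<Longrightarrow> subformulas \<phi> \<subseteq> F"
  shows "analytic_calculus lTS4 F"
proof -
  interpret common_extension lTS4 F
    using assms(2) by unfold_locales (auto intro: lTS4.common)
  show ?thesis
  proof
    fix \<Gamma> \<Delta> \<alpha>
    assume sat: "saturated lTS4 F \<Gamma> \<Delta>"
    obtain \<Gamma>1 \<Gamma>2 \<Delta>1 \<Delta>2 where parts:
      "\<And>\<beta>. \<beta> |\<in>| \<Gamma>1 \<longleftrightarrow> Box \<beta> |\<in>| \<Gamma>" "\<And>\<beta>. \<beta> |\<in>| \<Gamma>2 \<longleftrightarrow> Neg (Dia \<beta>) |\<in>| \<Gamma>"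
      "\<And>\<beta>. \<beta> |\<in>| \<Delta>1 \<longleftrightarrow> Dia \<beta> |\<in>| \<Delta>" "\<And>\<beta>. \<beta> |\<in>| \<Delta>2 \<longleftrightarrow> Neg (Box \<beta>) |\<in>| \<Delta>"
      using modal_parts[of \<Gamma> \<Delta>] by blast
    let ?G = "boxes \<Gamma>1 |\<union>| negs (dias \<Gamma>2)" and ?D = "dias \<Delta>1 |\<union>| negs (boxes \<Delta>2)"
    have sub: "?G |\<subseteq>| \<Gamma>" "?D |\<subseteq>| \<Delta>"
      using parts by auto
    then have inF: "fset ?G \<subseteq> F" "fset ?D \<subseteq> F"
      using saturated_in[OF sat] by blast+
    {
      assume h: "Box \<alpha> |\<in>| \<Delta> \<or> Neg (Box \<alpha>) |\<in>| \<Gamma>"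
      then have "\<alpha> \<in> F" "Box \<alpha> |\<in>| \<Delta> \<Longrightarrow> Box \<alpha> \<in> F" "Neg (Box \<alpha>) |\<in>| \<Gamma> \<Longrightarrow> Neg (Box \<alpha>) \<in> F"
        using saturated_in[OF sat] components_in by blast+
      \<comment> \<open>With context \<open>?G\<close>, \<open>?D\<close> the conclusion of the box
        rule on the right, or of the negated box rule on the left, is part of the saturated sequent.
        Were the premise derivable, so would be that part.\<close>
      then have "\<not> deriv lTS4 F (?G \<Rrightarrow> finsert \<alpha> ?D)"
        using h sub inF saturated_not_deriv[OF sat, of ?G "finsert (Box \<alpha>) ?D"]
          saturated_not_deriv[OF sat, of "finsert (Neg (Box \<alpha>)) ?G" ?D]
          derivI[of lTS4, OF lTS4.box_right[of \<Gamma>1 \<Gamma>2 \<alpha> \<Delta>1 \<Delta>2], of F]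
          derivI[of lTS4, OF lTS4.neg_box_left[of \<Gamma>1 \<Gamma>2 \<alpha> \<Delta>1 \<Delta>2], of F]
        by auto
      then show "\<exists>\<Gamma>' \<Delta>'. fset \<Gamma>' \<subseteq> F \<and> fset \<Delta>' \<subseteq> F \<and> \<not> deriv lTS4 F (\<Gamma>' \<Rrightarrow> \<Delta>') \<and> \<alpha> |\<in>| \<Delta>' \<and>
        pos_boxes \<Gamma> \<Delta> \<subseteq> pos_boxes \<Gamma>' \<Delta>' \<and> neg_dias \<Gamma> \<Delta> \<subseteq> neg_dias \<Gamma>' \<Delta>'"
        using inF \<open>\<alpha> \<in> F\<close> parts
        by (intro exI[of _ ?G] exI[of _ "finsert \<alpha> ?D"]) (auto simp: pos_boxes_def neg_dias_def)
    next
      assume h: "Dia \<alpha> |\<in>| \<Gamma> \<or> Neg (Dia \<alpha>) |\<in>| \<Delta>"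
      then have "\<alpha> \<in> F" "Dia \<alpha> |\<in>| \<Gamma> \<Longrightarrow> Dia \<alpha> \<in> F" "Neg (Dia \<alpha>) |\<in>| \<Delta> \<Longrightarrow> Neg (Dia \<alpha>) \<in> F"
        using saturated_in[OF sat] components_in by blast+
      then have "\<not> deriv lTS4 F (finsert \<alpha> ?G \<Rrightarrow> ?D)"
        using h sub inF saturated_not_deriv[OF sat, of "finsert (Dia \<alpha>) ?G" ?D]
          saturated_not_deriv[OF sat, of ?G "finsert (Neg (Dia \<alpha>)) ?D"]
          derivI[of lTS4, OF lTS4.dia_left[of \<alpha> \<Gamma>1 \<Gamma>2 \<Delta>1 \<Delta>2], of F]
          derivI[of lTS4, OF lTS4.neg_dia_right[of \<alpha> \<Gamma>1 \<Gamma>2 \<Delta>1 \<Delta>2], of F]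
        by auto
      then show "\<exists>\<Gamma>' \<Delta>'. fset \<Gamma>' \<subseteq> F \<and> fset \<Delta>' \<subseteq> F \<and> \<not> deriv lTS4 F (\<Gamma>' \<Rrightarrow> \<Delta>') \<and> \<alpha> |\<in>| \<Gamma>' \<and>
        pos_boxes \<Gamma> \<Delta> \<subseteq> pos_boxes \<Gamma>' \<Delta>' \<and> neg_dias \<Gamma> \<Delta> \<subseteq> neg_dias \<Gamma>' \<Delta>'"
        using inF \<open>\<alpha> \<in> F\<close> parts
        by (intro exI[of _ "finsert \<alpha> ?G"] exI[of _ ?D]) (auto simp: pos_boxes_def neg_dias_def)
    }
  qed (rule assms(1))
qed

lemma gTS4_analytic:
  assumes "finite F" and "\<And>\<phi>. \<phi> \<in> F \<Longrightarrow> subformulas \<phi> \<subseteq> F"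
  shows "analytic_calculus gTS4 F"
proof -
  interpret common_extension gTS4 F
    using assms(2) by unfold_locales (auto intro: gTS4.common)
  show ?thesis
  proof
    fix \<Gamma> \<Delta> \<alpha>
    assume sat: "saturated gTS4 F \<Gamma> \<Delta>"
    obtain \<Gamma>1 \<Gamma>2 \<Delta>1 \<Delta>2 where parts:
      "\<And>\<beta>. \<beta> |\<in>| \<Gamma>1 \<longleftrightarrow> Box \<beta> |\<in>| \<Gamma>" "\<And>\<beta>. \<beta> |\<in>| \<Gamma>2 \<longleftrightarrow> Neg (Dia \<beta>) |\<in>| \<Gamma>"
      "\<And>\<beta>. \<beta> |\<in>| \<Delta>1 \<longleftrightarrow> Dia \<beta> |\<in>| \<Delta>" "\<And>\<beta>. \<beta> |\<in>| \<Delta>2 \<longleftrightarrow> Neg (Box \<beta>) |\<in>| \<Delta>"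
      using modal_parts[of \<Gamma> \<Delta>] by blast
    let ?G = "boxes \<Gamma>1 |\<union>| negs (dias \<Gamma>2)" and ?D = "dias \<Delta>1 |\<union>| negs (boxes \<Delta>2)"
    let ?G' = "boxes \<Gamma>1 |\<union>| boxes \<Delta>2" and ?D' = "dias \<Delta>1 |\<union>| dias \<Gamma>2"
    have sub: "?G |\<subseteq>| \<Gamma>" "?D |\<subseteq>| \<Delta>"
      using parts by auto
    then have inF: "fset ?G \<subseteq> F" "fset ?D \<subseteq> F"
      using saturated_in[OF sat] by blast+
    \<comment> \<open>The premise contains \<open>Box \<beta>\<close> or \<open>Dia \<beta>\<close>
      where the conclusion has its negation, and these are subformulas of it.\<close>
    then have inF': "fset ?G' \<subseteq> F" "fset ?D' \<subseteq> F"
      using components_in(4) by auto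
    {
      assume h: "Box \<alpha> |\<in>| \<Delta> \<or> Neg (Box \<alpha>) |\<in>| \<Gamma>"
      then have "\<alpha> \<in> F" "Box \<alpha> |\<in>| \<Delta> \<Longrightarrow> Box \<alpha> \<in> F" "Neg (Box \<alpha>) |\<in>| \<Gamma> \<Longrightarrow> Neg (Box \<alpha>) \<in> F"
        using saturated_in[OF sat] components_in by blast+
      \<comment> \<open>The argument is that for \<open>lTS4\<close>, with premise context
        \<open>?G'\<close>, \<open>?D'\<close>. The rule parameters come in the order of their first
        occurrence in the premise, so \<open>\<Delta>2\<close> precedes
        \<open>\<Gamma>2\<close>.\<close>
      then have "\<not> deriv gTS4 F (?G' \<Rrightarrow> finsert \<alpha> ?D')"
        using h sub inF saturated_not_deriv[OF sat, of ?G "finsert (Box \<alpha>) ?D"]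
          saturated_not_deriv[OF sat, of "finsert (Neg (Box \<alpha>)) ?G" ?D]
          derivI[of gTS4, OF gTS4.box_right[of \<Gamma>1 \<Delta>2 \<alpha> \<Delta>1 \<Gamma>2], of F]
          derivI[of gTS4, OF gTS4.neg_box_left[of \<Gamma>1 \<Delta>2 \<alpha> \<Delta>1 \<Gamma>2], of F]
        by auto
      then show "\<exists>\<Gamma>' \<Delta>'. fset \<Gamma>' \<subseteq> F \<and> fset \<Delta>' \<subseteq> F \<and> \<not> deriv gTS4 F (\<Gamma>' \<Rrightarrow> \<Delta>') \<and> \<alpha> |\<in>| \<Delta>' \<and>
        pos_boxes \<Gamma> \<Delta> \<subseteq> pos_boxes \<Gamma>' \<Delta>' \<and> neg_dias \<Gamma> \<Delta> \<subseteq> neg_dias \<Gamma>' \<Delta>'"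
        using inF' \<open>\<alpha> \<in> F\<close> parts
        by (intro exI[of _ ?G'] exI[of _ "finsert \<alpha> ?D'"]) (auto simp: pos_boxes_def neg_dias_def)
    next
      assume h: "Dia \<alpha> |\<in>| \<Gamma> \<or> Neg (Dia \<alpha>) |\<in>| \<Delta>"
      then have "\<alpha> \<in> F" "Dia \<alpha> |\<in>| \<Gamma> \<Longrightarrow> Dia \<alpha> \<in> F" "Neg (Dia \<alpha>) |\<in>| \<Delta> \<Longrightarrow> Neg (Dia \<alpha>) \<in> F"
        using saturated_in[OF sat] components_in by blast+
      then have "\<not> deriv gTS4 F (finsert \<alpha> ?G' \<Rrightarrow> ?D')"
        using h sub inF saturated_not_deriv[OF sat, of "finsert (Dia \<alpha>) ?G" ?D]
          saturated_not_deriv[OF sat, of ?G "finsert (Neg (Dia \<alpha>)) ?D"]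
          derivI[of gTS4, OF gTS4.dia_left[of \<alpha> \<Gamma>1 \<Delta>2 \<Delta>1 \<Gamma>2], of F]
          derivI[of gTS4, OF gTS4.neg_dia_right[of \<alpha> \<Gamma>1 \<Delta>2 \<Delta>1 \<Gamma>2], of F]
        by auto
      then show "\<exists>\<Gamma>' \<Delta>'. fset \<Gamma>' \<subseteq> F \<and> fset \<Delta>' \<subseteq> F \<and> \<not> deriv gTS4 F (\<Gamma>' \<Rrightarrow> \<Delta>') \<and> \<alpha> |\<in>| \<Gamma>' \<and>
        pos_boxes \<Gamma> \<Delta> \<subseteq> pos_boxes \<Gamma>' \<Delta>' \<and> neg_dias \<Gamma> \<Delta> \<subseteq> neg_dias \<Gamma>' \<Delta>'"
        using inF' \<open>\<alpha> \<in> F\<close> parts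
        by (intro exI[of _ "finsert \<alpha> ?G'"] exI[of _ ?D']) (auto simp: pos_boxes_def neg_dias_def)
    }
  qed (rule assms(1))
qed

section \<open>From soundness and completeness to the subformula property\<close>

theorem theorem4p5:
  fixes L :: calculus
  assumes "L = lTS4 \<or> L = gTS4"
  shows "subformula_property L"
  unfolding subformula_property_def
proof (intro allI impI)
  fix S
  assume "provable L S"
  then obtain P where P: "is_proof L P" "end_sequent P = S"
    by (auto simp: provable_def proof_of_def)
  obtain \<Gamma> \<Delta> where S: "S = (\<Gamma> \<Rrightarrow> \<Delta>)"
    by (cases S)
  define F where "F = (\<Union>\<phi> \<in> sequent_formulas S. subformulas \<phi>)"
  have "finite F"
    by (simp add: F_def S finite_subformulas)
  moreover have "subformulas \<phi> \<subseteq> F" if "\<phi> \<in> F" for \<phi>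
    using that subformulas_trans by (fastforce simp: F_def)
  ultimately interpret analytic_calculus L F
    using assms lTS4_analytic gTS4_analytic by blast
  \<comment> \<open>The given proof may cut on arbitrary formulas; all that is taken from it is the
    validity of \<open>S\<close> in the model built from the subformulas of
    \<open>S\<close>.\<close>
  have "valid_in acc val S"
    using is_proof_sound[OF P(1), of acc val] lTS4_sound[OF _ reflp_acc transp_acc]
      gTS4_sound[OF _ reflp_acc transp_acc] assms P(2) by blast
  moreover have "fset \<Gamma> \<subseteq> F" "fset \<Delta> \<subseteq> F"
    using self_subformula by (auto simp: F_def S)
  ultimately have "deriv L F S"
    using complete by (simp add: S)
  then show "\<exists>P. proof_of L P S \<and>
      (\<forall>\<phi> \<in> proof_formulas P. \<exists>\<psi> \<in> sequent_formulas S. \<phi> \<in> subformulas \<psi>)"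
    using deriv_imp_proof[of L F S] by (fastforce simp: F_def)
qed

end
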